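(* Let $\kappa$ be a regular infinite cardinal and $\mu$ a singular cardinal with $\mathrm{cf}(\mu)=\kappa$. (1) If $\nu=\mu^{<\kappa}$, then $\mathfrak d({}^{\nu}\kappa,\le_{\mathrm{all}})\le\mathrm{cof}(\mathcal M_\kappa({}^{\kappa}\mu,\kappa))$. (2) If $\nu=\mu^{<\mu}$, then $\mathfrak d({}^{\nu}\kappa,\le_{\mathrm{all}})\le\mathrm{cof}(\mathcal M_\kappa({}^{\mu}\mu,\mathrm{bd}))$.
   Context: For ordinals $\delta,\rho$, ${}^{\delta}\rho$ is the set of functions $\delta\to\rho$; for a partial function $s\colon\delta\rightharpoonup\rho$, $[s]=\{f\in{}^{\delta}\rho: s\subseteq f\}$. The bounded topology $\mathrm{bd}$ on ${}^{\delta}\rho$ has base $\{[s]: s\in{}^{\alpha}\rho,\ \alpha<\delta\}$; on ${}^{\kappa}\mu$ it coincides with the ${<}\kappa$-box topology (base $[s]$, $|\mathrm{dom}(s)|<\kappa$), denoted $\kappa$. A set is $\kappa$-meagre if it is a union of at most $\kappa$ nowhere dense sets; $\mathcal M_\kappa(X,\tau)$ is the ideal of $\kappa$-meagre subsets; $\mathrm{cof}(\mathcal I)$ is the least size of $F\subseteq\mathcal I$ such that every $I\in\mathcal I$ is contained in some $J\in F$. For $f,g\in{}^{\nu}\kappa$, $f\le_{\mathrm{all}}g$ means $f(\gamma)\le g(\gamma)$ for all $\gamma<\nu$, and $\mathfrak d({}^{\nu}\kappa,\le_{\mathrm{all}})$ is the least size of $D\subseteq{}^{\nu}\kappa$ such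 that every $f\in{}^{\nu}\kappa$ has some $g\in D$ with $f\le_{\mathrm{all}}g$. *)

theory Defs
  imports "HOL-Analysis.Analysis"
begin

unbundle cardinal_syntax

text \<open>Cardinals/ordinals are represented by well-order relations on a type (Field = UNIV),
  which are card orders (initial ordinals).  Functions delta \<rightarrow> rho are HOL functions.\<close>

text \<open>Cylinder [s] for the partial function s = f restricted to D.\<close>
definition cyl :: "'a set \<Rightarrow> ('a \<Rightarrow> 'b) \<Rightarrow> ('a \<Rightarrow> 'b) set" where
  "cyl D f = {g. \<forall>x\<in>D. g x = f x}"

definition box_top :: "'k rel \<Rightarrow> ('k \<Rightarrow> 'm) topology" where
  "box_top rk = topology_generated_by {cyl D f | D f. |D| <o rk}"

definition bd_top :: "'d rel \<Rightarrow> ('d \<Rightarrow> 'r) topology" where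
  "bd_top rd = topology_generated_by {cyl (underS rd a) f | a f. a \<in> Field rd}"

definition nowhere_dense :: "'a topology \<Rightarrow> 'a set \<Rightarrow> bool" where
  "nowhere_dense T A \<longleftrightarrow> A \<subseteq> topspace T \<and> T interior_of (T closure_of A) = {}"

definition kmeagre :: "'k rel \<Rightarrow> 'a topology \<Rightarrow> 'a set \<Rightarrow> bool" where
  "kmeagre rk T A \<longleftrightarrow> (\<exists>\<N>. |\<N>| \<le>o rk \<and> (\<forall>N\<in>\<N>. nowhere_dense T N) \<and> A = \<Union>\<N>)"

definition meagre_ideal :: "'k rel \<Rightarrow> 'a topology \<Rightarrow> 'a set set" where
  "meagre_ideal rk T = {A. A \<subseteq> topspace T \<and> kmeagre rk T A}"

definition cofinal_family :: "'a set set \<Rightarrow> 'a set set \<Rightarrow> bool" where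
  "cofinal_family I F \<longleftrightarrow> F \<subseteq> I \<and> (\<forall>A\<in>I. \<exists>B\<in>F. A \<subseteq> B)"

definition dominating_all :: "'k rel \<Rightarrow> ('n \<Rightarrow> 'k) set \<Rightarrow> bool" where
  "dominating_all rk D \<longleftrightarrow> (\<forall>f. \<exists>g\<in>D. \<forall>\<gamma>. (f \<gamma>, g \<gamma>) \<in> rk)"

text \<open>The set of all s \<in> alpha \<rightarrow> rho for alpha < delta (partial maps with domain a proper
  initial segment of delta); its cardinality is rho^{<delta} for the cases at hand.\<close>
definition short_seqs :: "'d rel \<Rightarrow> ('d \<rightharpoonup> 'r) set" where
  "short_seqs rd = {p. \<exists>a\<in>Field rd. dom p = underS rd a}"

end

theory Submission
  imports Defs
begin

unbundle cardinal_syntax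

text \<open>Fix a cofinal \<open>\<kappa>\<close>-sequence \<open>q\<close> of positions.  After each position \<open>q i\<close> a point codes a short
  sequence, and a proper subset \<open>Z\<close> of the values, as large as the whole, suffices for coding.
  For \<open>f\<close> on short sequences, the closed nowhere dense set \<open>A\<close> of \<open>f\<close> consists of the points that never
  avoid \<open>Z\<close> on an interval from \<open>a\<close> to \<open>q j\<close>, where \<open>j\<close> bounds \<open>f\<close> on all sequences whose code
  ends by \<open>a\<close>.  If \<open>\<kappa>\<close> many nowhere dense sets cover \<open>A\<close>, then by the Baire category
  theorem one of them, \<open>N\<close>, is dense in a nonempty part of \<open>A\<close> above some short sequence \<open>t\<close>.
  To bound \<open>f s\<close>, code \<open>s\<close> after \<open>t\<close>, extend so as to avoid \<open>N\<close>, say up to position \<open>b\<close>, and continue in \<open>Z\<close>.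
  This point cannot lie in \<open>A\<close>, which forces \<open>q (f s)\<close> below \<open>b\<close>; and \<open>b\<close> depends only on \<open>N\<close>, \<open>t\<close> and \<open>s\<close>.
  So the members of a cofinal family, together with \<open>\<kappa> \<times> \<nu>\<close> parameters, give a dominating family.
  The parameters do not matter since \<open>\<nu>\<close> is at most the size of the family: otherwise choose
  outside each member a point coding at stage \<open>i0\<close> a sequence assigned to that member;
  these points form a nowhere dense set contained in no member.\<close>

text \<open>\<open>'k\<close> stands for \<kappa> and \<open>'d\<close> for the ordinal of
  positions, later \<kappa> or \<mu>. \<open>K_bounded\<close> is the regularity of \<kappa>;
  \<open>q_unbounded\<close> and \<open>D_bounded\<close> together say that the positions have
  cofinality \<kappa>.\<close>

locale coded_seqs =
  K: wellorder leK ltK + D: wellorder leD ltD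
  for leK :: "'k \<Rightarrow> 'k \<Rightarrow> bool" (infix "\<unlhd>" 50) and ltK (infix "\<lhd>" 50)
    and leD :: "'d \<Rightarrow> 'd \<Rightarrow> bool" (infix "\<sqsubseteq>" 50) and ltD (infix "\<sqsubset>" 50) +
  fixes q :: "'k \<Rightarrow> 'd" and e :: "'d \<Rightarrow> 'd \<Rightarrow> 'd"
    and cd :: "'d \<Rightarrow> 'm" and cm :: "'m \<Rightarrow> 'm" and Z :: "'m set"
  assumes q_mono: "i \<unlhd> j \<Longrightarrow> q i \<sqsubseteq> q j"
    and q_unbounded: "\<exists>i. a \<sqsubset> q i"
    and K_bounded: "\<exists>j. \<forall>i. i \<lhd> i0 \<longrightarrow> h i \<unlhd> j"
    and D_bounded: "\<exists>b. \<forall>i. i \<lhd> i0 \<longrightarrow> p i \<sqsubset> b"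
    and e_gt: "a \<sqsubset> e a b"
    and e_mono: "b \<sqsubset> c \<Longrightarrow> e a b \<sqsubset> e a c"
    and inj_cd: "inj cd" and inj_cm: "inj cm"
    and cd_Z: "cd a \<in> Z" and cm_Z: "cm v \<in> Z" and Z_proper: "Z \<noteq> UNIV"
begin

text \<open>\<open>e a\<close> plays the role of \<open>b \<mapsto> a + 1 + b\<close>; \<open>cd\<close> writes the length of a sequence and \<open>cm\<close> its entries.\<close>

definition agree :: "'d \<Rightarrow> ('d \<Rightarrow> 'm) \<Rightarrow> ('d \<Rightarrow> 'm) \<Rightarrow> bool" where
  "agree a x y \<longleftrightarrow> (\<forall>b. b \<sqsubset> a \<longrightarrow> x b = y b)"

text \<open>As the points \<open>y\<close> with \<open>agree a x y\<close> form a basic open set of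
  the bounded topology, this is nowhere density there, free of closures and interiors.\<close>

definition nwd :: "('d \<Rightarrow> 'm) set \<Rightarrow> bool" where
  "nwd N \<longleftrightarrow> (\<forall>x a. \<exists>y b. agree a x y \<and> (\<forall>z\<in>N. \<not> agree b y z))"

definition segs :: "('d \<rightharpoonup> 'm) set" where
  "segs = {s. \<exists>a. dom s = {b. b \<sqsubset> a}}"

text \<open>Off the ranges of \<open>cd\<close> and \<open>cm\<close> the inverses return arbitrary
  values, so every point decodes to some short sequence at every stage.\<close>

definition dec :: "('d \<Rightarrow> 'm) \<Rightarrow> 'k \<Rightarrow> ('d \<rightharpoonup> 'm)" where
  "dec x i = (\<lambda>b. if b \<sqsubset> inv cd (x (q i)) then Some (inv cm (x (e (q i) b))) else None)"

text \<open>By \<open>e_gt\<close> and \<open>e_mono\<close> this lies strictly above every position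
  that \<open>dec x i\<close> reads, so the values below it determine
  \<open>dec x i\<close>.\<close>

definition fin :: "('d \<Rightarrow> 'm) \<Rightarrow> 'k \<Rightarrow> 'd" where
  "fin x i = e (q i) (inv cd (x (q i)))"

definition rank :: "(('d \<rightharpoonup> 'm) \<Rightarrow> 'k) \<Rightarrow> ('d \<Rightarrow> 'm) \<Rightarrow> 'd \<Rightarrow> 'k" where
  "rank f x a = K.Least (\<lambda>j. \<forall>i. fin x i \<sqsubseteq> a \<longrightarrow> f (dec x i) \<unlhd> j)"

text \<open>The alternative \<open>b = a\<close> matters when \<open>q (rank f x a)\<close> lies
  below \<open>a\<close>: the interval is then \<open>a\<close> alone, and \<open>x a\<close> must
  be in \<open>Z\<close>.\<close>

definition slalom :: "(('d \<rightharpoonup> 'm) \<Rightarrow> 'k) \<Rightarrow> ('d \<Rightarrow> 'm) set" where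
  "slalom f = {x. \<forall>a. \<exists>b. a \<sqsubseteq> b \<and> (b = a \<or> b \<sqsubseteq> q (rank f x a)) \<and> x b \<in> Z}"

section \<open>Agreement below a position, and coding\<close>

lemma agree_refl [simp]: "agree a x x"
  by (simp add: agree_def)

lemma agree_sym: "agree a x y \<Longrightarrow> agree a y x"
  by (simp add: agree_def)

lemma agree_trans: "agree a x y \<Longrightarrow> agree a y z \<Longrightarrow> agree a x z"
  by (simp add: agree_def)

lemma agree_mono: "agree b x y \<Longrightarrow> a \<sqsubseteq> b \<Longrightarrow> agree a x y"
  by (meson agree_def D.less_le_trans)

lemma D_no_max: "\<exists>b. a \<sqsubset> b"
  using q_unbounded by blast

lemma ub2: "\<exists>c. a \<sqsubset> c \<and> b \<sqsubset> c"
  by (metis D_no_max D.less_trans D.linear D.le_less_trans)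

lemma nwd_avoid:
  assumes "nwd N"
  obtains y b where "agree a x y" "a \<sqsubseteq> b" "\<And>z. z \<in> N \<Longrightarrow> \<not> agree b y z"
proof -
  obtain y b where *: "agree a x y" "\<forall>z\<in>N. \<not> agree b y z"
    using assms unfolding nwd_def by metis
  obtain c where c: "a \<sqsubset> c" "b \<sqsubset> c" using ub2 by blast
  show thesis
    by (rule that[of y c]) (use * c in \<open>auto dest: agree_mono[of c] D.less_imp_le\<close>)
qed

lemma q_lt_fin: "q i \<sqsubset> fin x i"
  by (simp add: fin_def e_gt)

lemma dec_in_segs: "dec x i \<in> segs"
  by (auto simp: segs_def dec_def dom_def)

lemma dec_cong:
  assumes "agree a x y" "fin x i \<sqsubseteq> a"
  shows "dec y i = dec x i" "fin y i = fin x i"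
proof -
  have "y (q i) = x (q i)"
    using assms q_lt_fin[of i x] by (simp add: agree_def D.less_le_trans)
  moreover have "y (e (q i) b) = x (e (q i) b)" if "b \<sqsubset> inv cd (x (q i))" for b
    using assms e_mono[OF that, of "q i"] by (simp add: agree_def fin_def D.less_le_trans)
  ultimately show "dec y i = dec x i" "fin y i = fin x i"
    by (auto simp: dec_def fin_def)
qed

lemma fin_le_cong: "agree a x y \<Longrightarrow> fin x i \<sqsubseteq> a \<longleftrightarrow> fin y i \<sqsubseteq> a"
  by (metis dec_cong(2) agree_sym)

lemma e_inj: "e a b = e a c \<Longrightarrow> b = c"
  by (metis D.less_irrefl D.neq_iff e_mono)

text \<open>The values of \<open>w\<close> lie in \<open>Z\<close> even at positions that carry no
  information, so any initial piece ending by \<open>q i\<close> can be continued to code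
  \<open>s\<close> without leaving \<open>Z\<close>.\<close>

lemma encode:
  assumes "s \<in> segs"
  obtains w where "\<And>c. w c \<in> Z" "\<And>y. (\<And>c. q i \<sqsubseteq> c \<Longrightarrow> y c = w c) \<Longrightarrow> dec y i = s"
proof -
  obtain a where a: "dom s = {b. b \<sqsubset> a}" using assms by (auto simp: segs_def)
  define w where "w c = (if c = q i then cd a else cm (the (s (inv (e (q i)) c))))" for c
  have inj: "inj (e (q i))" by (auto intro: injI e_inj)
  show thesis
  proof (rule that)
    show "w c \<in> Z" for c by (simp add: w_def cd_Z cm_Z)
    fix y assume y: "\<And>c. q i \<sqsubseteq> c \<Longrightarrow> y c = w c"
    have "w (e (q i) b) = cm (the (s b))" for b
      using e_gt[of "q i" b] inj by (auto simp: w_def)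
    then have "y (e (q i) b) = cm (the (s b))" for b
      using y[OF D.less_imp_le[OF e_gt]] by simp
    moreover have "y (q i) = cd a" using y by (simp add: w_def)
    ultimately have "dec y i b = (if b \<sqsubset> a then Some (the (s b)) else None)" for b
      using inj_cd inj_cm by (simp add: dec_def)
    moreover have "b \<sqsubset> a \<longleftrightarrow> s b \<noteq> None" for b
      using a by (auto simp: set_eq_iff domIff)
    ultimately have "dec y i b = s b" for b by simp
    then show "dec y i = s" by blast
  qed
qed

section \<open>Ranks and the nowhere dense sets \<open>slalom f\<close>\<close>

lemma rank_bound: "\<exists>j. \<forall>i. fin x i \<sqsubseteq> a \<longrightarrow> f (dec x i) \<unlhd> j"
proof -
  obtain i0 where i0: "a \<sqsubset> q i0" using q_unbounded by blast
  \<comment> \<open>A code ending by \<open>a\<close> starts below \<open>a\<close>, so only stages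
    below \<open>i0\<close> count and regularity of \<kappa> bounds the values of
    \<open>f\<close>.\<close>
  have "i \<lhd> i0" if "fin x i \<sqsubseteq> a" for i
    using q_mono[of i0 i] q_lt_fin[of i x] that i0
    by (meson D.less_imp_le D.less_irrefl D.less_le_trans D.order_trans K.not_le)
  then show ?thesis using K_bounded[of i0 "\<lambda>i. f (dec x i)"] by blast
qed

lemma rank_ge: "fin x i \<sqsubseteq> a \<Longrightarrow> f (dec x i) \<unlhd> rank f x a"
  using K.LeastI_ex[OF rank_bound[of x a f]] by (simp add: rank_def)

lemma rank_cong:
  assumes "agree a x y"
  shows "rank f x a = rank f y a"
proof -
  have "(fin x i \<sqsubseteq> a \<longrightarrow> f (dec x i) \<unlhd> j) \<longleftrightarrow> (fin y i \<sqsubseteq> a \<longrightarrow> f (dec y i) \<unlhd> j)" for i j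
    using fin_le_cong[OF assms] dec_cong(1)[OF assms] by auto
  then show ?thesis by (simp add: rank_def)
qed

text \<open>The rank at \<open>a\<close> depends only on the values below \<open>a\<close>. Hence
  writing a value outside \<open>Z\<close> from \<open>a\<close> on cannot raise it, and the whole
  interval is soon missed.\<close>

lemma slalom_nwd: "nwd (slalom f)"
  unfolding nwd_def
proof (intro allI)
  fix x a
  obtain v where v: "v \<notin> Z" using Z_proper by blast
  define y where "y c = (if c \<sqsubset> a then x c else v)" for c
  obtain d where d: "a \<sqsubset> d" "q (rank f y a) \<sqsubset> d" using ub2 by blast
  have "\<not> agree d y z" if z: "z \<in> slalom f" for z
  proof
    assume ag: "agree d y z"
    have "rank f z a = rank f y a"
      using rank_cong[OF agree_mono[OF ag]] d by (simp add: D.less_imp_le)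
    then obtain b where b: "a \<sqsubseteq> b" "b = a \<or> b \<sqsubseteq> q (rank f y a)" "z b \<in> Z"
      using z unfolding slalom_def mem_Collect_eq by metis
    then have "b \<sqsubset> d" using d by (auto intro: D.le_less_trans)
    then have "z b = v" using ag b(1) by (auto simp: agree_def y_def D.not_le[symmetric])
    with b v show False by simp
  qed
  moreover have "agree a x y" by (simp add: agree_def y_def)
  ultimately show "\<exists>y b. agree a x y \<and> (\<forall>z\<in>slalom f. \<not> agree b y z)" by blast
qed

text \<open>Why the Baire argument works inside \<^term>\<open>slalom f\<close>: filling up with values in \<^term>\<open>Z\<close> makes \<^term>\<open>slalom f\<close>
  closed under unions of chains of initial pieces.\<close>
lemma slalom_fill:
  assumes B: "\<And>c. c \<in> B \<Longrightarrow> \<exists>y\<in>slalom f. \<forall>b. b \<sqsubseteq> c \<longrightarrow> x b = y b"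
    and Z: "\<And>c. c \<notin> B \<Longrightarrow> x c \<in> Z"
  shows "x \<in> slalom f"
  unfolding slalom_def
proof (intro CollectI allI)
  fix a
  \<comment> \<open>The right end of the interval. Outside \<open>B\<close> it carries a value in
    \<open>Z\<close>; inside \<open>B\<close> some member of \<open>slalom f\<close> agrees with
    \<open>x\<close> on the whole interval.\<close>
  define m where "m = (if a \<sqsubseteq> q (rank f x a) then q (rank f x a) else a)"
  have m: "a \<sqsubseteq> m" "m = a \<or> m \<sqsubseteq> q (rank f x a)" by (auto simp: m_def)
  have m_max: "b \<sqsubseteq> m" if "b = a \<or> b \<sqsubseteq> q (rank f x a)" for b
    using that D.linear by (auto simp: m_def intro: D.order_trans)
  show "\<exists>b. a \<sqsubseteq> b \<and> (b = a \<or> b \<sqsubseteq> q (rank f x a)) \<and> x b \<in> Z"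
  proof (cases "m \<in> B")
    case False
    then show ?thesis using m Z by blast
  next
    case True
    then obtain y where y: "y \<in> slalom f" "\<forall>b. b \<sqsubseteq> m \<longrightarrow> x b = y b" using B by blast
    have "agree a x y" using y(2) m(1) by (meson agree_def D.less_imp_le D.order_trans)
    then have "rank f y a = rank f x a" by (rule rank_cong[symmetric])
    then obtain b where "a \<sqsubseteq> b" "b = a \<or> b \<sqsubseteq> q (rank f x a)" "y b \<in> Z"
      using y(1) unfolding slalom_def mem_Collect_eq by metis
    then show ?thesis using m_max y(2) by metis
  qed
qed

section \<open>The Baire category theorem relative to a set\<close>

text \<open>\<open>closed\<close> takes the place of completeness, and \<open>N\<close> says that
  each \<open>N i\<close> is nowhere dense relative to \<open>A\<close>. The construction of length
  \<kappa> then stays inside \<open>A\<close>; \<open>D_bounded\<close> keeps the lengths bounded at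
  limit stages.\<close>

lemma baire:
  fixes N :: "'k \<Rightarrow> ('d \<Rightarrow> 'm) set"
  assumes closed: "\<And>x B. (\<And>c. c \<in> B \<Longrightarrow> \<exists>y\<in>A. \<forall>b. b \<sqsubseteq> c \<longrightarrow> x b = y b)
      \<Longrightarrow> (\<And>b c. c \<in> B \<Longrightarrow> b \<sqsubseteq> c \<Longrightarrow> b \<in> B) \<Longrightarrow> \<exists>y\<in>A. \<forall>b\<in>B. x b = y b"
    and N: "\<And>i x a. x \<in> A \<Longrightarrow> \<exists>y\<in>A. agree a x y \<and> (\<exists>b. \<forall>z\<in>N i. \<not> agree b y z)"
    and x0: "x0 \<in> A"
  shows "\<exists>y\<in>A. agree a0 x0 y \<and> (\<forall>i. y \<notin> N i)"
proof -
  \<comment> \<open>In a pair \<open>(x, a)\<close> only the values of \<open>x\<close> below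
    \<open>a\<close> are committed; the rest of \<open>x\<close> witnesses that this piece extends
    into \<open>A\<close>.\<close>
  define P where "P h i r \<longleftrightarrow> (case r of (x, a) \<Rightarrow> x \<in> A \<and> q i \<sqsubseteq> a \<and> a0 \<sqsubseteq> a
      \<and> agree a0 x0 x \<and> (\<forall>z\<in>N i. \<not> agree a x z)
      \<and> (\<forall>j. j \<lhd> i \<longrightarrow> snd (h j) \<sqsubseteq> a \<and> agree (snd (h j)) (fst (h j)) x))"
    for h :: "'k \<Rightarrow> ('d \<Rightarrow> 'm) \<times> 'd" and i r
  \<comment> \<open>Needed twice: for the stages below \<open>i\<close> during the recursion, and
    for all stages at the end.\<close>
  have glue: "\<exists>y\<in>A. agree a0 x0 y \<and> (\<forall>j\<in>J. agree (snd (h j)) (fst (h j)) y)"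
    if h: "\<And>j. j \<in> J \<Longrightarrow> P h j (h j)" for h J
  proof -
    have coh: "fst (h j) b = fst (h k) b"
      if "j \<in> J" "k \<in> J" "b \<sqsubset> snd (h j)" "b \<sqsubset> snd (h k)" for j k b
      using h[OF that(1)] h[OF that(2)] that(3,4)
      by (cases j k rule: K.linorder_cases) (auto simp: P_def agree_def split: prod.splits)
    have base: "agree a0 x0 (fst (h j))" if "j \<in> J" for j
      using h[OF that] by (auto simp: P_def split: prod.splits)
    have inA: "fst (h j) \<in> A" if "j \<in> J" for j
      using h[OF that] by (auto simp: P_def split: prod.splits)
    define x where "x b = (if \<exists>j\<in>J. b \<sqsubset> snd (h j)
        then fst (h (SOME j. j \<in> J \<and> b \<sqsubset> snd (h j))) b else x0 b)" for b
    have x_eq: "x b = fst (h j) b" if "j \<in> J" "b \<sqsubset> snd (h j)" for j b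
    proof -
      have "\<exists>j. j \<in> J \<and> b \<sqsubset> snd (h j)" using that by blast
      from someI_ex[OF this] have "fst (h (SOME j. j \<in> J \<and> b \<sqsubset> snd (h j))) b = fst (h j) b"
        by (intro coh) (use that in simp_all)
      moreover have "\<exists>j\<in>J. b \<sqsubset> snd (h j)" using that by blast
      ultimately show ?thesis unfolding x_def by (simp only: if_True)
    qed
    have x_eq0: "x b = x0 b" if "b \<sqsubset> a0" for b
    proof (cases "\<exists>j\<in>J. b \<sqsubset> snd (h j)")
      case True
      then show ?thesis using x_eq base that by (auto simp: agree_def)
    qed (simp add: x_def)
    define B where "B = {b. b \<sqsubset> a0 \<or> (\<exists>j\<in>J. b \<sqsubset> snd (h j))}"
    have "\<exists>y\<in>A. \<forall>b\<in>B. x b = y b"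
    proof (rule closed)
      fix c assume "c \<in> B"
      then consider "c \<sqsubset> a0" | j where "j \<in> J" "c \<sqsubset> snd (h j)" by (auto simp: B_def)
      then show "\<exists>y\<in>A. \<forall>b. b \<sqsubseteq> c \<longrightarrow> x b = y b"
      proof cases
        case 1
        then show ?thesis using x0 x_eq0 D.le_less_trans by blast
      next
        case 2
        then show ?thesis using inA x_eq D.le_less_trans by blast
      qed
    next
      fix b c assume "c \<in> B" "b \<sqsubseteq> c"
      then show "b \<in> B" unfolding B_def using D.le_less_trans by blast
    qed
    then obtain y where y: "y \<in> A" "\<forall>b\<in>B. x b = y b" by blast
    have "agree a0 x0 y"
      unfolding agree_def using y(2) x_eq0 by (metis (mono_tags, lifting) B_def mem_Collect_eq)
    moreover have "agree (snd (h j)) (fst (h j)) y" if "j \<in> J" for j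
      unfolding agree_def using y(2) x_eq[OF that] that
      by (metis (mono_tags, lifting) B_def mem_Collect_eq)
    ultimately show ?thesis using y(1) by blast
  qed
  have "\<exists>h. \<forall>i. P h i (h i)"
  proof (rule dependent_wf_choice[of "{(i, j). i \<lhd> j}"])
    show "wf {(i, j). i \<lhd> j}" by (rule K.wf)
    show "P g i r = P h i r" if "\<And>z. (z, i) \<in> {(i, j). i \<lhd> j} \<Longrightarrow> g z = h z" for g h i r
      using that by (auto simp: P_def)
    fix i h assume "\<And>j. (j, i) \<in> {(i, j). i \<lhd> j} \<Longrightarrow> P h j (h j)"
    then have "\<And>j. j \<in> {j. j \<lhd> i} \<Longrightarrow> P h j (h j)" by simp
    from glue[of "{j. j \<lhd> i}" h, OF this] obtain x where x: "x \<in> A" "agree a0 x0 x"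
      "\<forall>j. j \<lhd> i \<longrightarrow> agree (snd (h j)) (fst (h j)) x" by auto
    obtain a1 where a1: "\<forall>j. j \<lhd> i \<longrightarrow> snd (h j) \<sqsubset> a1"
      using D_bounded[of i "\<lambda>j. snd (h j)"] by blast
    obtain a2 where a2: "a1 \<sqsubset> a2" "a0 \<sqsubset> a2" using ub2 by blast
    obtain a3 where a3: "a2 \<sqsubset> a3" "q i \<sqsubset> a3" using ub2 by blast
    obtain y b where y: "y \<in> A" "agree a3 x y" "\<forall>z\<in>N i. \<not> agree b y z"
      using N[OF x(1)] by blast
    obtain a where a: "a3 \<sqsubset> a" "b \<sqsubset> a" using ub2 by blast
    have le: "a0 \<sqsubseteq> a3" "q i \<sqsubseteq> a3" "a3 \<sqsubseteq> a" "b \<sqsubseteq> a" "\<And>j. j \<lhd> i \<Longrightarrow> snd (h j) \<sqsubseteq> a3"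
      using a a1 a2 a3 by (meson D.less_imp_le D.less_trans)+
    have "snd (h j) \<sqsubseteq> a \<and> agree (snd (h j)) (fst (h j)) y" if j: "j \<lhd> i" for j
    proof
      show "snd (h j) \<sqsubseteq> a" using le(5)[OF j] le(3) by (rule D.order_trans)
      have "agree (snd (h j)) (fst (h j)) x" using x(3) j by blast
      then show "agree (snd (h j)) (fst (h j)) y"
        using agree_mono[OF y(2) le(5)[OF j]] by (rule agree_trans)
    qed
    then have "P h i (y, a)"
      unfolding P_def using x(1,2) y le(1-4)
      by (auto intro: D.order_trans agree_trans agree_mono)
    then show "\<exists>r. P h i r" by blast
  qed
  then obtain h where h: "\<And>i. P h i (h i)" by blast
  from glue[of UNIV h, OF h] obtain y where y: "y \<in> A" "agree a0 x0 y"
    "\<And>j. agree (snd (h j)) (fst (h j)) y" by auto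
  have "y \<notin> N i" for i
    using y(3)[of i] h[of i] by (auto simp: P_def split: prod.splits)
  then show ?thesis using y by blast
qed

lemma baire_UNIV:
  fixes N :: "'k \<Rightarrow> ('d \<Rightarrow> 'm) set"
  assumes "\<And>i. nwd (N i)"
  shows "\<exists>y. agree a x y \<and> (\<forall>i. y \<notin> N i)"
proof -
  have "\<exists>y\<in>UNIV. agree a x y \<and> (\<forall>i. y \<notin> N i)"
  proof (rule baire)
    show "\<exists>y\<in>UNIV. agree a x y \<and> (\<exists>b. \<forall>z\<in>N i. \<not> agree b y z)" for i x a
      using assms[of i] unfolding nwd_def by blast
  qed auto
  then show ?thesis by blast
qed

text \<open>Filling with a value in \<open>Z\<close> provides the closure property that
  \<open>baire\<close> asks for. So some \<open>N i\<close> is not nowhere dense relative to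
  \<open>slalom f\<close>, that is, it is dense in a part of \<open>slalom f\<close>.\<close>

lemma baire_slalom:
  fixes N :: "'k \<Rightarrow> ('d \<Rightarrow> 'm) set"
  assumes "slalom f \<subseteq> (\<Union>i. N i)"
  obtains x a i where "x \<in> slalom f"
    "\<And>y b. y \<in> slalom f \<Longrightarrow> agree a x y \<Longrightarrow> \<exists>z\<in>N i. agree b y z"
proof -
  obtain v where v: "v \<in> Z" using cd_Z by blast
  have ex: "(\<lambda>_. v) \<in> slalom f"
    by (rule slalom_fill[of "{}"]) (use v in auto)
  have "\<not> (\<forall>i x a. x \<in> slalom f \<longrightarrow> (\<exists>y\<in>slalom f. agree a x y \<and> (\<exists>b. \<forall>z\<in>N i. \<not> agree b y z)))"
  proof
    assume *: "\<forall>i x a. x \<in> slalom f \<longrightarrow> (\<exists>y\<in>slalom f. agree a x y \<and> (\<exists>b. \<forall>z\<in>N i. \<not> agree b y z))"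
    \<comment> \<open>Any starting position would do, hence \<open>undefined\<close>.\<close>
    have "\<exists>y\<in>slalom f. agree undefined (\<lambda>_. v) y \<and> (\<forall>i. y \<notin> N i)"
    proof (rule baire)
      fix x B
      assume B: "\<And>c. c \<in> B \<Longrightarrow> \<exists>y\<in>slalom f. \<forall>b. b \<sqsubseteq> c \<longrightarrow> x b = y b"
        and down: "\<And>b c. c \<in> B \<Longrightarrow> b \<sqsubseteq> c \<Longrightarrow> b \<in> B"
      define x' where "x' b = (if b \<in> B then x b else v)" for b
      have "x' \<in> slalom f"
      proof (rule slalom_fill)
        fix c assume c: "c \<in> B"
        then have "\<forall>b. b \<sqsubseteq> c \<longrightarrow> x' b = x b" using down by (auto simp: x'_def)
        then show "\<exists>y\<in>slalom f. \<forall>b. b \<sqsubseteq> c \<longrightarrow> x' b = y b" using B[OF c] by simp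
      qed (simp add: x'_def v)
      then show "\<exists>y\<in>slalom f. \<forall>b\<in>B. x b = y b" by (rule rev_bexI) (simp add: x'_def)
    qed (use * ex in auto)
    then show False using assms by blast
  qed
  then show thesis using that by blast
qed

section \<open>Reading off a bound for \<open>f\<close>\<close>

text \<open>The order of quantifiers is the point: \<open>g\<close> depends on \<open>N\<close>,
  \<open>a\<close> and \<open>t\<close> only and serves all \<open>f\<close> and \<open>x\<close>.
  The last premise says that \<open>N\<close> is dense in the part of \<open>slalom f\<close> above
  the restriction of \<open>x\<close> to positions below \<open>a\<close>.\<close>

lemma slalom_bound:
  assumes N: "nwd N"
  shows "\<exists>g. \<forall>f x. x \<in> slalom f \<longrightarrow> (\<forall>b. b \<sqsubset> a \<longrightarrow> x b = t b)
      \<longrightarrow> (\<forall>y b. y \<in> slalom f \<longrightarrow> agree a x y \<longrightarrow> (\<exists>z\<in>N. agree b y z))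
      \<longrightarrow> (\<forall>s\<in>segs. f s \<unlhd> g s)"
proof -
  \<comment> \<open>The code of \<open>s\<close> will start at \<open>q i\<close>, so that it does
    not overwrite \<open>t\<close>.\<close>
  obtain i where i: "a \<sqsubset> q i" using q_unbounded by blast
  have "\<exists>j. \<forall>f x. x \<in> slalom f \<longrightarrow> (\<forall>b. b \<sqsubset> a \<longrightarrow> x b = t b)
      \<longrightarrow> (\<forall>y b. y \<in> slalom f \<longrightarrow> agree a x y \<longrightarrow> (\<exists>z\<in>N. agree b y z)) \<longrightarrow> f s \<unlhd> j"
    if s: "s \<in> segs" for s
  proof -
    obtain w where w: "\<And>c. w c \<in> Z" "\<And>y. (\<And>c. q i \<sqsubseteq> c \<Longrightarrow> y c = w c) \<Longrightarrow> dec y i = s"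
      using encode[OF s, of i] by metis
    define u where "u c = (if c \<sqsubset> a then t c else w c)" for c
    have uZ: "u c \<in> Z" if "a \<sqsubseteq> c" for c
      using that w(1) by (auto simp: u_def D.not_less[symmetric])
    have "u c = w c" if "q i \<sqsubseteq> c" for c
      using that i by (auto simp: u_def dest: D.less_trans D.le_less_trans)
    then have dec_u: "dec u i = s" by (rule w(2))
    have a_fin: "a \<sqsubset> fin u i" using i q_lt_fin D.less_trans by blast
    obtain y b where y: "agree (fin u i) u y" "fin u i \<sqsubseteq> b" "\<And>z. z \<in> N \<Longrightarrow> \<not> agree b y z"
      using nwd_avoid[OF N] by metis
    define y' where "y' c = (if c \<sqsubset> b then y c else w c)" for c
    have ag: "agree (fin u i) u y'"
      using y(1,2) by (auto simp: agree_def y'_def dest: D.less_le_trans)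
    have dec_y': "dec y' i = s" "fin y' i = fin u i"
      using dec_cong[OF ag] dec_u by auto
    \<comment> \<open>The bound is fixed here, before any \<open>f\<close> or \<open>x\<close> is
      considered.\<close>
    obtain j where j: "b \<sqsubset> q j" using q_unbounded by blast
    show ?thesis
    proof (intro exI[of _ j] allI impI)
      fix f x
      assume x: "x \<in> slalom f" "\<forall>b. b \<sqsubset> a \<longrightarrow> x b = t b"
        and hit: "\<forall>y b. y \<in> slalom f \<longrightarrow> agree a x y \<longrightarrow> (\<exists>z\<in>N. agree b y z)"
      have u: "u \<in> slalom f"
      proof (rule slalom_fill[of "{c. c \<sqsubset> a}"])
        fix c assume "c \<in> {c. c \<sqsubset> a}"
        then have "\<forall>b. b \<sqsubseteq> c \<longrightarrow> u b = x b"
          using x by (auto simp: u_def dest: D.le_less_trans)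
        then show "\<exists>y\<in>slalom f. \<forall>b. b \<sqsubseteq> c \<longrightarrow> u b = y b" using x(1) by blast
      qed (simp add: uZ D.not_less)
      have "agree a x u" using x(2) by (simp add: agree_def u_def)
      moreover have "agree a u y'" using ag a_fin by (auto intro: agree_mono D.less_imp_le)
      moreover have "agree b y y'" by (simp add: agree_def y'_def)
      then have "\<not> agree b y' z" if "z \<in> N" for z
        using y(3)[OF that] agree_trans by blast
      ultimately have "y' \<notin> slalom f" using hit agree_trans by blast
      then obtain c where c: "\<And>d. c \<sqsubseteq> d \<Longrightarrow> d = c \<or> d \<sqsubseteq> q (rank f y' c) \<Longrightarrow> y' d \<notin> Z"
        unfolding slalom_def by blast
      have Z_b: "y' d \<in> Z" if "b \<sqsubseteq> d" for d
        using that w(1) by (auto simp: y'_def D.not_less[symmetric])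
      have cb: "c \<sqsubset> b" using c[of c] Z_b[of c] by (auto simp: D.not_le[symmetric])
      have qb: "q (rank f y' c) \<sqsubset> b"
        using c[of "q (rank f y' c)"] Z_b[of "q (rank f y' c)"] cb
        by (meson D.less_imp_le D.not_le D.order_trans D.order_refl)
      \<comment> \<open>Otherwise \<open>y'\<close> and \<open>u\<close> have the same rank at
        \<open>c\<close>, and \<open>u\<close> meets \<open>Z\<close> in the interval. Either this
        happens where \<open>y'\<close> still equals \<open>u\<close>, or the interval reaches the
        end of the code and contains the larger of \<open>a\<close> and \<open>c\<close>, where
        \<open>y'\<close> equals \<open>u\<close> and \<open>u\<close> is in
        \<open>Z\<close>.\<close>
      have "fin u i \<sqsubseteq> c"
      proof (rule ccontr)
        assume "\<not> fin u i \<sqsubseteq> c"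
        then have c_fin: "c \<sqsubset> fin u i" by (simp add: D.not_le)
        have rk: "rank f y' c = rank f u c"
          using rank_cong[OF agree_mono[OF ag D.less_imp_le[OF c_fin]]] by simp
        obtain d where d: "c \<sqsubseteq> d" "d = c \<or> d \<sqsubseteq> q (rank f u c)" "u d \<in> Z"
          using u by (auto simp: slalom_def)
        show False
        proof (cases "d \<sqsubset> fin u i")
          case True
          then have "y' d = u d" using ag by (simp add: agree_def)
          then show False using c[of d] d rk by simp
        next
          case False
          then have d': "fin u i \<sqsubseteq> d" by (simp add: D.not_less)
          then have "d \<sqsubseteq> q (rank f u c)" using d c_fin by (auto dest: D.le_less_trans)
          define m where "m = (if a \<sqsubseteq> c then c else a)"
          have m: "c \<sqsubseteq> m" "a \<sqsubseteq> m" "m \<sqsubset> fin u i"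
            using c_fin a_fin D.linear by (auto simp: m_def)
          then have "m \<sqsubseteq> q (rank f y' c)"
            using rk d' \<open>d \<sqsubseteq> q (rank f u c)\<close> by (auto intro: D.less_imp_le D.order_trans)
          then have "y' m \<notin> Z" using c m(1) by blast
          moreover have "y' m = u m" using ag m(3) by (simp add: agree_def)
          ultimately show False using uZ[OF m(2)] by simp
        qed
      qed
      then have "f s \<unlhd> rank f y' c" using rank_ge[of y' i c f] dec_y' by simp
      moreover have "rank f y' c \<unlhd> j"
        using q_mono[of j "rank f y' c"] qb j
        by (meson D.less_irrefl D.less_le_trans D.less_trans K.linear)
      ultimately show "f s \<unlhd> j" by (rule K.order_trans)
    qed
  qed
  then show ?thesis by metis
qed

section \<open>From a cofinal family to a dominating family of no larger size\<close>

lemma card_segs_le: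
  fixes F :: "('d \<Rightarrow> 'm) set set"
  assumes F: "\<And>A. nwd A \<Longrightarrow> \<exists>M\<in>F. A \<subseteq> M"
    and meagre: "\<And>M. M \<in> F \<Longrightarrow> \<exists>N :: 'k \<Rightarrow> _. (\<forall>i. nwd (N i)) \<and> M \<subseteq> (\<Union>i. N i)"
  shows "|segs| \<le>o |F|"
proof (rule ccontr)
  assume "\<not> |segs| \<le>o |F|"
  then have "|F| \<le>o |segs|" using ordLeq_total[OF card_of_Well_order card_of_Well_order] by blast
  then obtain \<phi> where \<phi>: "inj_on \<phi> F" "\<phi> ` F \<subseteq> segs" unfolding card_of_ordLeq[symmetric] by blast
  fix i0 :: 'k
  have "\<exists>x. dec x i0 = \<phi> M \<and> x \<notin> M" if M: "M \<in> F" for M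
  proof -
    obtain N :: "'k \<Rightarrow> _" where N: "\<And>i. nwd (N i)" "M \<subseteq> (\<Union>i. N i)" using meagre[OF M] by blast
    obtain w where w: "dec w i0 = \<phi> M" using encode[of "\<phi> M" i0] \<phi>(2) M by (metis image_subset_iff)
    obtain y where y: "agree (fin w i0) w y" "\<forall>i. y \<notin> N i" using baire_UNIV[of N] N(1) by blast
    then have "dec y i0 = \<phi> M" using dec_cong(1) w by simp
    then show ?thesis using y(2) N(2) by blast
  qed
  then obtain X where X: "\<And>M. M \<in> F \<Longrightarrow> dec (X M) i0 = \<phi> M" "\<And>M. M \<in> F \<Longrightarrow> X M \<notin> M" by metis
  have "nwd (X ` F)"
    unfolding nwd_def
  proof (intro allI)
    fix x a
    show "\<exists>y b. agree a x y \<and> (\<forall>z\<in>X ` F. \<not> agree b y z)"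
    proof (cases "\<exists>M\<in>F. agree a x (X M)")
      case False
      then show ?thesis using agree_refl by blast
    next
      case True
      then obtain M where M: "M \<in> F" "agree a x (X M)" by blast
      obtain c where c: "a \<sqsubset> c" "fin (X M) i0 \<sqsubset> c" using ub2 by blast
      obtain d where d: "c \<sqsubset> d" using D_no_max by blast
      obtain v where v: "v \<noteq> X M c" using Z_proper cd_Z by (metis UNIV_eq_I)
      \<comment> \<open>The change comes after the code of \<open>\<phi> M\<close> has ended. A
        point \<open>X M'\<close> agreeing with \<open>y\<close> that far decodes to
        \<open>\<phi> M\<close>, so it is \<open>X M\<close>, which differs from \<open>y\<close> at
        \<open>c\<close>.\<close>
      define y where "y = (X M)(c := v)"
      have ag: "agree c (X M) y" by (simp add: agree_def y_def)
      have "\<not> agree d y (X M')" if M': "M' \<in> F" for M'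
      proof
        assume *: "agree d y (X M')"
        then have "agree c (X M) (X M')" using ag d agree_mono agree_trans D.less_imp_le by blast
        then have "\<phi> M' = \<phi> M" using dec_cong(1)[of c] c(2) X(1) M(1) M' by (metis D.less_imp_le)
        then have "M' = M" using \<phi>(1) M(1) M' by (auto dest: inj_onD)
        then show False using * d v by (auto simp: agree_def y_def)
      qed
      moreover have "agree a x y" using M(2) ag c(1) agree_mono agree_trans D.less_imp_le by blast
      ultimately show ?thesis by blast
    qed
  qed
  then obtain M where "M \<in> F" "X ` F \<subseteq> M" using F by blast
  then show False using X(2) by blast
qed

theorem dominating_le_cofinal:
  fixes F :: "('d \<Rightarrow> 'm) set set"
  assumes F: "\<And>A. nwd A \<Longrightarrow> \<exists>M\<in>F. A \<subseteq> M"
    and meagre: "\<And>M. M \<in> F \<Longrightarrow> \<exists>N :: 'k \<Rightarrow> _. (\<forall>i. nwd (N i)) \<and> M \<subseteq> (\<Union>i. N i)"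
    and card_K: "|UNIV :: 'k set| \<le>o |UNIV :: 'd set|" and inf_D: "infinite (UNIV :: 'd set)"
  shows "\<exists>G :: (('d \<rightharpoonup> 'm) \<Rightarrow> 'k) set. |G| \<le>o |F| \<and> (\<forall>f. \<exists>g\<in>G. \<forall>s\<in>segs. f s \<unlhd> g s)"
proof -
  obtain N :: "('d \<Rightarrow> 'm) set \<Rightarrow> 'k \<Rightarrow> ('d \<Rightarrow> 'm) set"
    where N: "\<And>M i. M \<in> F \<Longrightarrow> nwd (N M i)" "\<And>M. M \<in> F \<Longrightarrow> M \<subseteq> (\<Union>i. N M i)"
    using meagre by metis
  define bounds where "bounds M i s g \<longleftrightarrow> (\<forall>f x a. dom s = {b. b \<sqsubset> a} \<longrightarrow> x \<in> slalom f
      \<longrightarrow> (\<forall>b. b \<sqsubset> a \<longrightarrow> x b = the (s b))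
      \<longrightarrow> (\<forall>y b. y \<in> slalom f \<longrightarrow> agree a x y \<longrightarrow> (\<exists>z\<in>N M i. agree b y z))
      \<longrightarrow> (\<forall>s\<in>segs. f s \<unlhd> g s))" for M i and s :: "'d \<rightharpoonup> 'm" and g
  have "\<exists>g. bounds M i s g" if M: "M \<in> F" and s: "s \<in> segs" for M i s
  proof -
    obtain a where a: "dom s = {b. b \<sqsubset> a}" using s by (auto simp: segs_def)
    \<comment> \<open>The domain of \<open>s\<close> determines \<open>a\<close>, so a single
      \<open>g\<close> meets the universally quantified \<open>bounds\<close>.\<close>
    have "a' = a" if "{b. b \<sqsubset> a'} = {b. b \<sqsubset> a}" for a'
      using that by (metis D.less_irrefl D.neq_iff mem_Collect_eq)
    then show ?thesis
      using slalom_bound[OF N(1)[OF M, of i], of a "\<lambda>b. the (s b)"] a unfolding bounds_def by metis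
  qed
  then have g: "bounds M i s (SOME g. bounds M i s g)" if "M \<in> F" "s \<in> segs" for M i s
    using that by (metis someI_ex)
  define g where "g M i s = (SOME g. bounds M i s g)" for M i s
  note g = g[folded g_def]
  define G where "G = (\<lambda>(M, i, s). g M i s) ` (F \<times> (UNIV :: 'k set) \<times> segs)"
  have "\<exists>g\<in>G. \<forall>s\<in>segs. f s \<unlhd> g s" for f
  proof -
    obtain M where M: "M \<in> F" "slalom f \<subseteq> M" using F[OF slalom_nwd] by blast
    obtain x a i where x: "x \<in> slalom f"
      and hit: "\<And>y b. y \<in> slalom f \<Longrightarrow> agree a x y \<Longrightarrow> \<exists>z\<in>N M i. agree b y z"
      using baire_slalom[of f "N M"] M N(2) by (metis order_trans)
    define s where "s b = (if b \<sqsubset> a then Some (x b) else None)" for b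
    have dom: "dom s = {b. b \<sqsubset> a}" by (auto simp: s_def dom_def)
    then have s: "s \<in> segs" by (auto simp: segs_def)
    have "\<forall>b. b \<sqsubset> a \<longrightarrow> x b = the (s b)" by (simp add: s_def)
    then have "\<forall>s'\<in>segs. f s' \<unlhd> g M i s s'"
      using g[OF M(1) s, of i] dom x hit unfolding bounds_def by blast
    then show ?thesis unfolding G_def using M(1) s by force
  qed
  moreover have "|G| \<le>o |F|"
  proof -
    \<comment> \<open>One constant sequence of each length embeds the positions into
      \<open>segs\<close>. Thus \<open>F\<close> is infinite and absorbs the factors \<kappa> and
      \<open>segs\<close>.\<close>
    have "inj (\<lambda>a b. if b \<sqsubset> a then Some undefined else (None :: 'm option))"
      by (rule injI) (metis D.less_irrefl D.neq_iff option.distinct(1))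
    moreover have "range (\<lambda>a b. if b \<sqsubset> a then Some undefined else (None :: 'm option)) \<subseteq> segs"
      by (auto simp: segs_def dom_def)
    ultimately have D_segs: "|UNIV :: 'd set| \<le>o |segs|"
      using card_of_ordLeq by blast
    have segs_F: "|segs| \<le>o |F|" by (rule card_segs_le[OF F meagre])
    then have inf_F: "infinite F"
      using card_of_ordLeq_infinite[OF ordLeq_transitive[OF D_segs segs_F] inf_D] by blast
    have card_UNIV_F: "|UNIV :: 'k set| \<le>o |F|"
      by (rule ordLeq_transitive[OF card_K ordLeq_transitive[OF D_segs segs_F]])
    have inf_field: "infinite (Field |F| )" using inf_F by (simp add: Field_card_of)
    note times_F = card_of_Times_ordLeq_infinite_Field[OF inf_field _ _ card_of_Card_order]
    have "|F \<times> (UNIV :: 'k set) \<times> segs| \<le>o |F|"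
      by (rule times_F[OF card_of_mono1[OF subset_refl] times_F[OF card_UNIV_F segs_F]])
    then show ?thesis unfolding G_def by (rule ordLeq_transitive[OF card_of_image])
  qed
  ultimately show ?thesis by blast
qed

end

section \<open>Card orders as well-orders, and the bounded topology\<close>

lemma Field_card_order: "card_order r \<Longrightarrow> Field r = UNIV"
  using card_order_on_Card_order by blast

lemma Card_order_card_order: "card_order r \<Longrightarrow> Card_order r"
  using card_order_on_Card_order by blast

lemma wellorder_card_order:
  assumes "card_order r"
  shows "class.wellorder (\<lambda>a b. (a, b) \<in> r) (\<lambda>a b. a \<in> underS r b)"
proof -
  have W: "well_order r" using assms by (simp add: card_order_on_def)
  then have R: "refl r" "trans r" "antisym r" "total r" "wf (r - Id)"
    by (simp_all add: well_order_on_def linear_order_on_def partial_order_on_def preorder_on_def)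
  show ?thesis
  proof unfold_locales
    show "a \<in> underS r b \<longleftrightarrow> (a, b) \<in> r \<and> (b, a) \<notin> r" for a b
      using R(1,3) by (auto simp: underS_def refl_on_def antisym_def)
    show "(a, a) \<in> r" for a using R(1) by (auto simp: refl_on_def)
    show "(a, c) \<in> r" if "(a, b) \<in> r" "(b, c) \<in> r" for a b c using R(2) that by (auto dest: transD)
    show "a = b" if "(a, b) \<in> r" "(b, a) \<in> r" for a b using R(3) that by (auto dest: antisymD)
    show "(a, b) \<in> r \<or> (b, a) \<in> r" for a b
      using R(1,4) by (cases "a = b") (auto simp: total_on_def refl_on_def)
    show "P a" if "\<And>x. (\<And>y. y \<in> underS r x \<Longrightarrow> P y) \<Longrightarrow> P x" for P a
      using R(5) by (induction a rule: wf_induct_rule) (use that in \<open>auto simp: underS_def\<close>)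
  qed
qed

lemma cyl_refl [simp]: "x \<in> cyl D x"
  by (simp add: cyl_def)

text \<open>Two cylinders around the same point both contain a longer one, so the generating sets
  already form a base.\<close>

lemma openin_bd_top:
  assumes rd: "card_order rd"
  shows "openin (bd_top rd) U \<longleftrightarrow> (\<forall>x\<in>U. \<exists>a. cyl (underS rd a) x \<subseteq> U)"
proof
  interpret D: wellorder "\<lambda>a b. (a, b) \<in> rd" "\<lambda>a b. a \<in> underS rd b"
    by (rule wellorder_card_order[OF rd])
  assume "openin (bd_top rd) U"
  then have "generate_topology_on {cyl (underS rd a) f | a f. a \<in> Field rd} U"
    by (simp add: bd_top_def openin_topology_generated_by_iff)
  then show "\<forall>x\<in>U. \<exists>a. cyl (underS rd a) x \<subseteq> U"
  proof induction
    case (Int V W)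
    show ?case
    proof
      fix x assume x: "x \<in> V \<inter> W"
      obtain a b where "cyl (underS rd a) x \<subseteq> V" "cyl (underS rd b) x \<subseteq> W"
        using Int.IH x by blast
      moreover obtain c where "(a, c) \<in> rd" "(b, c) \<in> rd" using D.linear D.order_refl by blast
      then have "cyl (underS rd c) x \<subseteq> cyl (underS rd a) x" "cyl (underS rd c) x \<subseteq> cyl (underS rd b) x"
        using D.less_le_trans by (fastforce simp: cyl_def)+
      ultimately show "\<exists>a. cyl (underS rd a) x \<subseteq> V \<inter> W" by blast
    qed
  next
    case (Basis s)
    then obtain a f where "s = cyl (underS rd a) f" by blast
    then have "\<forall>x\<in>s. cyl (underS rd a) x \<subseteq> s" by (auto simp: cyl_def)
    then show ?case by blast
  qed blast+
next
  assume *: "\<forall>x\<in>U. \<exists>a. cyl (underS rd a) x \<subseteq> U"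
  have "openin (bd_top rd) (\<Union>{cyl (underS rd a) x | a x. cyl (underS rd a) x \<subseteq> U})"
    unfolding bd_top_def using Field_card_order[OF rd]
    by (intro openin_Union) (auto intro!: topology_generated_by_Basis)
  moreover have "\<Union>{cyl (underS rd a) x | a x. cyl (underS rd a) x \<subseteq> U} = U"
  proof (rule subset_antisym)
    show "U \<subseteq> \<Union>{cyl (underS rd a) x | a x. cyl (underS rd a) x \<subseteq> U}"
    proof
      fix x assume "x \<in> U"
      then obtain a where "cyl (underS rd a) x \<subseteq> U" using * by blast
      then show "x \<in> \<Union>{cyl (underS rd a) x | a x. cyl (underS rd a) x \<subseteq> U}"
        by (intro UnionI[of "cyl (underS rd a) x"]) auto
    qed
  qed auto
  ultimately show "openin (bd_top rd) U" by simp
qed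

lemma topspace_bd_top: "card_order rd \<Longrightarrow> topspace (bd_top rd) = UNIV"
  using openin_subset[of "bd_top rd" UNIV] by (auto simp: openin_bd_top)

lemma nowhere_dense_bd_top:
  assumes rd: "card_order rd"
  shows "nowhere_dense (bd_top rd) A \<longleftrightarrow>
    (\<forall>x a. \<exists>y b. y \<in> cyl (underS rd a) x \<and> cyl (underS rd b) y \<inter> A = {})"
proof -
  have op: "openin (bd_top rd) (cyl (underS rd a) x)" for a and x :: "'a \<Rightarrow> 'b"
  proof -
    have "cyl (underS rd a) y \<subseteq> cyl (underS rd a) x" if "y \<in> cyl (underS rd a) x" for y
      using that by (auto simp: cyl_def)
    then show ?thesis unfolding openin_bd_top[OF rd] by blast
  qed
  have clos: "y \<in> bd_top rd closure_of A \<longleftrightarrow> (\<forall>b. cyl (underS rd b) y \<inter> A \<noteq> {})" for y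
  proof
    assume *: "y \<in> bd_top rd closure_of A"
    show "\<forall>b. cyl (underS rd b) y \<inter> A \<noteq> {}"
      using * op[of _ y] cyl_refl[of y] unfolding in_closure_of by blast
  next
    assume *: "\<forall>b. cyl (underS rd b) y \<inter> A \<noteq> {}"
    show "y \<in> bd_top rd closure_of A"
      unfolding in_closure_of openin_bd_top[OF rd] topspace_bd_top[OF rd] using * by blast
  qed
  have int: "bd_top rd interior_of B = {} \<longleftrightarrow> (\<forall>x a. \<not> cyl (underS rd a) x \<subseteq> B)"
    for B :: "('a \<Rightarrow> 'b) set"
  proof
    assume *: "bd_top rd interior_of B = {}"
    show "\<forall>x a. \<not> cyl (underS rd a) x \<subseteq> B"
    proof (intro allI notI)
      fix x a assume "cyl (underS rd a) x \<subseteq> B"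
      then have "x \<in> bd_top rd interior_of B"
        unfolding interior_of_def using op[of a x] cyl_refl[of x] by blast
      with * show False by simp
    qed
  next
    assume *: "\<forall>x a. \<not> cyl (underS rd a) x \<subseteq> B"
    show "bd_top rd interior_of B = {}"
      unfolding interior_of_def openin_bd_top[OF rd] using * by blast
  qed
  show ?thesis
    unfolding nowhere_dense_def topspace_bd_top[OF rd] int subset_iff clos by blast
qed

section \<open>Bounds, cofinality and final segments\<close>

lemma card_order_no_max:
  assumes "card_order r" "infinite (UNIV :: 'a set)"
  shows "\<exists>b. a \<in> underS (r :: 'a rel) b"
  using infinite_Card_order_limit[OF Card_order_card_order[OF assms(1)], of a] assms(2)
    Field_card_order[OF assms(1)] by (auto simp: underS_def)

text \<open>\<open>cofinal\<close> asks for strictly larger elements, so its failure gives only a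
  weak bound \<open>a\<close>; a larger \<open>b\<close> makes it strict.\<close>

lemma bounded_if_small:
  assumes "card_order rd" and "infinite (UNIV :: 'd set)" and "\<not> cofinal C (rd :: 'd rel)"
  shows "\<exists>b. \<forall>c\<in>C. c \<in> underS rd b"
proof -
  interpret D: wellorder "\<lambda>a b. (a, b) \<in> rd" "\<lambda>a b. a \<in> underS rd b"
    by (rule wellorder_card_order[OF assms(1)])
  obtain a where a: "\<And>c. c \<in> C \<Longrightarrow> a = c \<or> (a, c) \<notin> rd"
    using assms(3) by (auto simp: cofinal_def)
  obtain b where b: "a \<in> underS rd b" using card_order_no_max[OF assms(1,2)] by blast
  have "c \<in> underS rd b" if "c \<in> C" for c
    using a[OF that] b D.le_less_trans D.linear by blast
  then show ?thesis by blast
qed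

lemma cofinal_iff:
  assumes "card_order r"
  shows "cofinal C r \<longleftrightarrow> (\<forall>a. \<exists>c\<in>C. a \<in> underS r c)"
  using Field_card_order[OF assms] by (auto simp: cofinal_def underS_def)

lemma not_cofinal_if_regular:
  assumes "card_order rk" "regularCard rk" "|C| <o rk"
  shows "\<not> cofinal C rk"
  using assms not_ordLess_ordIso Field_card_order[OF assms(1)] unfolding regularCard_def by blast

lemma embed_above:
  fixes rd :: "'d rel"
  assumes rd: "card_order rd" and inf: "infinite (UNIV :: 'd set)"
  shows "\<exists>e. (\<forall>b. a \<in> underS rd (e b)) \<and> (\<forall>b c. b \<in> underS rd c \<longrightarrow> e b \<in> underS rd (e c))"
proof -
  interpret D: wellorder "\<lambda>a b. (a, b) \<in> rd" "\<lambda>a b. a \<in> underS rd b"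
    by (rule wellorder_card_order[OF rd])
  note F = Field_card_order[OF rd] and C = Card_order_card_order[OF rd]
  have W: "Well_order rd" using C by (simp add: card_order_on_def)
  let ?A = "{b. a \<in> underS rd b}"
  obtain a' where a': "a \<in> underS rd a'"
    using card_order_no_max[OF rd inf] by blast
  have "- ?A \<subseteq> underS rd a'"
    using a' D.not_less D.le_less_trans by blast
  then have small: "|- ?A| <o rd"
    using card_of_underS[OF C, of a'] F card_of_mono1 ordLeq_ordLess_trans by blast
  \<comment> \<open>An infinite initial ordinal is order-isomorphic to each of its final segments.\<close>
  have "\<not> |?A| <o rd"
  proof
    assume "|?A| <o rd"
    then have "|?A \<union> - ?A| <o rd"
      by (intro card_of_Un_ordLess_infinite_Field) (use F C inf small in auto)
    then have "|UNIV :: 'd set| <o rd" by (simp only: Compl_partition)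
    then show False
      using card_of_unique[OF rd] not_ordLess_ordIso ordIso_symmetric by blast
  qed
  then have "rd \<le>o |?A|" using W card_of_Well_order not_ordLess_iff_ordLeq by blast
  \<comment> \<open>\<open>|?A|\<close> is least among the well-orders of \<open>?A\<close>, in
    particular below the order inherited from \<open>rd\<close>.\<close>
  also have "|?A| \<le>o Restr rd ?A"
    using well_order_on_Restr[OF W, of ?A] F card_of_least by blast
  finally obtain e where e: "embed rd (Restr rd ?A) e" by (auto simp: ordLeq_def)
  have "inj e" using embed_inj_on[OF W e] F by simp
  moreover have "(e b, e c) \<in> rd" if "(b, c) \<in> rd" for b c
    using embed_compat[OF e] that by (auto simp: compat_def)
  moreover have "e b \<in> ?A" for b
    using embed_in_Field[OF e, of b] F Field_Restr_subset[of rd ?A] by (auto simp only: UNIV_I)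
  ultimately show ?thesis by (auto simp: underS_def inj_eq intro!: exI[of _ e])
qed

section \<open>The bound for the bounded topology\<close>

text \<open>Stated for positions \<open>rd\<close> of cofinality \<kappa>, so that
  \<open>rd = rk\<close> and \<open>rd = rm\<close> yield the two parts of the theorem.\<close>

lemma dominating_le_cofinal_bd_top:
  fixes rk :: "'k rel" and rd :: "'d rel" and F :: "('d \<Rightarrow> 'm) set set"
  assumes rk: "card_order rk" and inf: "infinite (UNIV :: 'k set)" and reg: "regularCard rk"
    and rd: "card_order rd"
    and kd: "|UNIV :: 'k set| \<le>o |UNIV :: 'd set|" and dm: "|UNIV :: 'd set| \<le>o |UNIV :: 'm set|"
    and cof: "cofinal C rd" "|C| =o rk" and cof_min: "\<And>C. |C| <o rk \<Longrightarrow> \<not> cofinal C rd"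
    and F: "cofinal_family (meagre_ideal rk (bd_top rd)) F"
    and n: "|UNIV :: 'n set| =o |short_seqs rd :: ('d \<rightharpoonup> 'm) set|"
  shows "\<exists>D :: ('n \<Rightarrow> 'k) set. dominating_all rk D \<and> |D| \<le>o |F|"
proof -
  interpret K: wellorder "\<lambda>a b. (a, b) \<in> rk" "\<lambda>a b. a \<in> underS rk b"
    by (rule wellorder_card_order[OF rk])
  interpret D: wellorder "\<lambda>a b. (a, b) \<in> rd" "\<lambda>a b. a \<in> underS rd b"
    by (rule wellorder_card_order[OF rd])
  have infd: "infinite (UNIV :: 'd set)" using card_of_ordLeq_infinite[OF kd inf] .
  have infm: "infinite (UNIV :: 'm set)" using card_of_ordLeq_infinite[OF dm infd] .
  have small: "|h ` underS rk i| <o rk" for h :: "'k \<Rightarrow> 'z" and i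
    using card_of_underS[OF Card_order_card_order[OF rk], of i] Field_card_order[OF rk]
      ordLeq_ordLess_trans[OF card_of_image] by blast
  have K_bounded: "\<exists>b. \<forall>i. i \<in> underS rk i0 \<longrightarrow> h i \<in> underS rk b" for h i0
    using bounded_if_small[OF rk inf not_cofinal_if_regular[OF rk reg small]] by blast
  have D_bounded: "\<exists>b. \<forall>i. i \<in> underS rk i0 \<longrightarrow> h i \<in> underS rd b" for h i0
    using bounded_if_small[OF rd infd cof_min[OF small]] by blast

  have "|UNIV :: 'k set| =o |C|"
    using cof(2) card_of_unique[OF rk] ordIso_symmetric ordIso_transitive by blast
  then obtain h where h: "bij_betw h (UNIV :: 'k set) C" by (auto simp: card_of_ordIso[symmetric])
  \<comment> \<open>An enumeration of \<open>C\<close> need not be monotone, hence the least upper bounds.\<close>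
  define q where "q i = D.Least (\<lambda>b. \<forall>j. j \<in> underS rk i \<longrightarrow> h j \<in> underS rd b)" for i
  have q_ub: "h j \<in> underS rd (q i)" if "j \<in> underS rk i" for i j
    using D.LeastI_ex[OF D_bounded[of i h]] that by (simp add: q_def)
  have q_mono: "(q i, q j) \<in> rd" if "(i, j) \<in> rk" for i j
    unfolding q_def[of i] by (rule D.Least_le) (use q_ub that K.less_le_trans in blast)
  have q_unb: "\<exists>i. a \<in> underS rd (q i)" for a
  proof -
    obtain j where "a \<in> underS rd (h j)"
      using cof(1) h unfolding cofinal_iff[OF rd] bij_betw_def by blast
    moreover obtain i where "j \<in> underS rk i"
      using card_order_no_max[OF rk inf] by blast
    ultimately show ?thesis using q_ub D.less_trans by blast
  qed
  obtain e where e: "\<And>a b. a \<in> underS rd (e a b)"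
    "\<And>a b c. b \<in> underS rd c \<Longrightarrow> e a b \<in> underS rd (e a c)"
    using embed_above[OF rd infd] by metis
  \<comment> \<open>Omitting one point from an infinite type makes \<open>range cm\<close> a proper
    subset of full size; lengths are sent into it by \<open>cm \<circ> dm\<close>.\<close>
  obtain cm :: "'m \<Rightarrow> 'm" where "bij_betw cm UNIV (UNIV - {undefined})"
    using infinite_imp_bij_betw[OF infm] by blast
  then have cm: "inj cm" "range cm \<noteq> UNIV" by (auto simp: bij_betw_def)
  obtain dm :: "'d \<Rightarrow> 'm" where dm: "inj dm" using dm by (auto simp: card_of_ordLeq[symmetric])

  interpret coded_seqs "\<lambda>a b. (a, b) \<in> rk" "\<lambda>a b. a \<in> underS rk b"
      "\<lambda>a b. (a, b) \<in> rd" "\<lambda>a b. a \<in> underS rd b" q e "cm \<circ> dm" cm "range cm"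
  proof unfold_locales
    show "\<exists>j. \<forall>i. i \<in> underS rk i0 \<longrightarrow> (h i, j) \<in> rk" for h i0
      using K_bounded[of i0 h] K.less_imp_le by blast
  qed (use q_mono q_unb D_bounded e cm dm in \<open>auto simp: inj_compose\<close>)

  have agree_cyl: "agree a x y \<longleftrightarrow> y \<in> cyl (underS rd a) x" for a x y
    by (auto simp: agree_def cyl_def)
  have nwd: "nwd A \<longleftrightarrow> nowhere_dense (bd_top rd) A" for A
    unfolding nwd_def nowhere_dense_bd_top[OF rd] agree_cyl by blast
  have segs: "segs = short_seqs rd"
    by (auto simp: segs_def short_seqs_def Field_card_order[OF rd])
  have "\<exists>G :: (('d \<rightharpoonup> 'm) \<Rightarrow> 'k) set. |G| \<le>o |F| \<and> (\<forall>f. \<exists>g\<in>G. \<forall>s\<in>segs. (f s, g s) \<in> rk)"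
  proof (rule dominating_le_cofinal)
    fix A assume A: "nwd A"
    have "|{A}| \<le>o rk"
      using card_of_mono1[of "{undefined}" "UNIV :: 'k set"] card_of_unique[OF rk]
      by (metis card_of_singl_ordLeq UNIV_not_empty ordIso_symmetric ordLeq_ordIso_trans)
    then have "A \<in> meagre_ideal rk (bd_top rd)"
      using A unfolding meagre_ideal_def kmeagre_def nwd
      by (auto simp: topspace_bd_top[OF rd] intro!: exI[of _ "{A}"])
    then show "\<exists>M\<in>F. A \<subseteq> M" using F by (auto simp: cofinal_family_def)
  next
    fix M assume "M \<in> F"
    then obtain \<N> where N: "|\<N>| \<le>o rk" "\<And>N. N \<in> \<N> \<Longrightarrow> nwd N" "M = \<Union>\<N>"
      using F by (auto simp: cofinal_family_def meagre_ideal_def kmeagre_def nwd)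
    show "\<exists>N :: 'k \<Rightarrow> _. (\<forall>i. nwd (N i)) \<and> M \<subseteq> (\<Union>i. N i)"
    proof (cases "\<N> = {}")
      case True
      have "nwd {}" by (auto simp: nwd_def intro: agree_refl)
      with True N(3) show ?thesis by (intro exI[of _ "\<lambda>_. {}"]) simp
    next
      case False
      have "|\<N>| \<le>o |UNIV :: 'k set|" using N(1) card_of_unique[OF rk] ordLeq_ordIso_trans by blast
      then obtain h where "h ` (UNIV :: 'k set) = \<N>" using card_of_ordLeq2[OF False] by metis
      then show ?thesis using N(2,3) by (intro exI[of _ h]) auto
    qed
  qed (use kd infd in auto)
  then obtain G :: "(('d \<rightharpoonup> 'm) \<Rightarrow> 'k) set"
    where G: "|G| \<le>o |F|" "\<And>f. \<exists>g\<in>G. \<forall>s\<in>segs. (f s, g s) \<in> rk" by blast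
  obtain \<psi> :: "'n \<Rightarrow> 'd \<rightharpoonup> 'm" where \<psi>: "bij_betw \<psi> UNIV segs"
    using n unfolding segs by (auto simp: card_of_ordIso[symmetric])
  have "dominating_all rk ((\<lambda>g. g \<circ> \<psi>) ` G)"
    unfolding dominating_all_def
  proof
    fix f :: "'n \<Rightarrow> 'k"
    obtain g where "g \<in> G" "\<forall>s\<in>segs. (f (inv \<psi> s), g s) \<in> rk"
      using G(2)[of "\<lambda>s. f (inv \<psi> s)"] by blast
    moreover have "inv \<psi> (\<psi> \<gamma>) = \<gamma>" "\<psi> \<gamma> \<in> segs" for \<gamma>
      using \<psi> by (auto simp: bij_betw_def)
    ultimately show "\<exists>g\<in>(\<lambda>g. g \<circ> \<psi>) ` G. \<forall>\<gamma>. (f \<gamma>, g \<gamma>) \<in> rk"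
      by (metis comp_apply imageI)
  qed
  moreover have "|(\<lambda>g. g \<circ> \<psi>) ` G| \<le>o |F|"
    by (rule ordLeq_transitive[OF card_of_image G(1)])
  ultimately show ?thesis by blast
qed

section \<open>The box topology, and both parts of the theorem\<close>

lemma openin_if_subbasis_open:
  assumes "\<And>S. S \<in> \<S> \<Longrightarrow> openin T S" and "openin (topology_generated_by \<S>) U"
  shows "openin T U"
  by (rule generate_topology_on_coarsest[OF istopology_openin assms(1)
        openin_topology_generated_by[OF assms(2)]])

text \<open>By regularity a domain of size below \<kappa> is bounded in \<kappa>, and conversely
  proper initial segments of \<kappa> have size below \<kappa>.\<close>

lemma box_top_eq_bd_top:
  fixes rk :: "'k rel"
  assumes rk: "card_order rk" and inf: "infinite (UNIV :: 'k set)" and reg: "regularCard rk"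
  shows "(box_top rk :: ('k \<Rightarrow> 'm) topology) = bd_top rk"
proof -
  interpret K: wellorder "\<lambda>a b. (a, b) \<in> rk" "\<lambda>a b. a \<in> underS rk b"
    by (rule wellorder_card_order[OF rk])
  have "openin (bd_top rk) U" if "openin (box_top rk) U" for U :: "('k \<Rightarrow> 'm) set"
  proof -
    have "openin (bd_top rk) (cyl D f)" if D: "|D| <o rk" for D and f :: "'k \<Rightarrow> 'm"
    proof -
      obtain a where "\<forall>c\<in>D. c \<in> underS rk a"
        using bounded_if_small[OF rk inf not_cofinal_if_regular[OF rk reg D]] by blast
      then have "cyl (underS rk a) x \<subseteq> cyl D f" if "x \<in> cyl D f" for x
        using that by (auto simp: cyl_def)
      then show ?thesis by (auto simp: openin_bd_top[OF rk])
    qed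
    then have "openin (bd_top rk) V" if "V \<in> {cyl D f | D f. |D| <o rk}" for V :: "('k \<Rightarrow> 'm) set"
      using that by blast
    then show ?thesis
      by (rule openin_if_subbasis_open[OF _ that[unfolded box_top_def]])
  qed
  moreover have "openin (box_top rk) U" if "openin (bd_top rk) U" for U :: "('k \<Rightarrow> 'm) set"
  proof -
    have "openin (box_top rk) (cyl (underS rk a) f)" for a and f :: "'k \<Rightarrow> 'm"
      using card_of_underS[OF Card_order_card_order[OF rk], of a] Field_card_order[OF rk]
      unfolding box_top_def by (intro topology_generated_by_Basis) blast
    then have "openin (box_top rk) V" if "V \<in> {cyl (underS rk a) f | a f. a \<in> Field rk}"
      for V :: "('k \<Rightarrow> 'm) set" using that by blast
    then show ?thesis
      by (rule openin_if_subbasis_open[OF _ that[unfolded bd_top_def]])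
  qed
  ultimately show ?thesis by (auto simp: topology_eq)
qed

theorem mainTheorem18:
  fixes rk :: "'k rel" and rm :: "'m rel"
  assumes kappa_card: "card_order rk" and kappa_inf: "cinfinite rk" and kappa_reg: "regularCard rk"
    and mu_card: "card_order rm"
    and mu_cf: "\<exists>C. C \<subseteq> Field rm \<and> cofinal C rm \<and> |C| =o rk"
    and mu_cf_min: "\<forall>C. C \<subseteq> Field rm \<and> cofinal C rm \<longrightarrow> rk \<le>o |C|"
    and mu_sing: "rk <o rm"
  shows
    "( |(UNIV :: 'n1 set)| =o |(short_seqs rk :: ('k \<rightharpoonup> 'm) set)| \<longrightarrow>
       (\<forall>F. cofinal_family (meagre_ideal rk (box_top rk :: ('k \<Rightarrow> 'm) topology)) F \<longrightarrow>
          (\<exists>D :: ('n1 \<Rightarrow> 'k) set. dominating_all rk D \<and> |D| \<le>o |F| )))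
   \<and> ( |(UNIV :: 'n2 set)| =o |(short_seqs rm :: ('m \<rightharpoonup> 'm) set)| \<longrightarrow>
       (\<forall>F. cofinal_family (meagre_ideal rk (bd_top rm :: ('m \<Rightarrow> 'm) topology)) F \<longrightarrow>
          (\<exists>D :: ('n2 \<Rightarrow> 'k) set. dominating_all rk D \<and> |D| \<le>o |F| )))"
proof -
  have inf: "infinite (UNIV :: 'k set)"
    using kappa_inf Field_card_order[OF kappa_card] by (simp add: cinfinite_def)
  have refl: "|A| \<le>o |A|" for A :: "'z set" by (rule card_of_mono1) simp
  have km: "|UNIV :: 'k set| \<le>o |UNIV :: 'm set|"
    using ordLess_imp_ordLeq[OF mu_sing] card_of_unique[OF kappa_card] card_of_unique[OF mu_card]
      ordIso_ordLeq_trans ordLeq_ordIso_trans ordIso_symmetric by metis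
  have cof_k: "cofinal UNIV rk"
    using card_order_no_max[OF kappa_card inf] by (simp add: cofinal_iff[OF kappa_card])
  have card_k: "|UNIV :: 'k set| =o rk" by (rule ordIso_symmetric[OF card_of_unique[OF kappa_card]])
  obtain C where C: "cofinal C rm" "|C| =o rk" using mu_cf by blast
  have cof_min: "\<not> cofinal C rm" if "|C| <o rk" for C
    using mu_cf_min that not_ordLess_ordLeq Field_card_order[OF mu_card] by blast
  \<comment> \<open>In the first part all of \<kappa> serves as the cofinal set of positions, in the
    second the set \<open>C\<close> of size \<kappa> in \<mu>.\<close>
  note part1 = dominating_le_cofinal_bd_top[OF kappa_card inf kappa_reg kappa_card refl km
      cof_k card_k not_cofinal_if_regular[OF kappa_card kappa_reg]]
  note part2 = dominating_le_cofinal_bd_top[OF kappa_card inf kappa_reg mu_card km refl C cof_min]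
  show ?thesis
    unfolding box_top_eq_bd_top[OF kappa_card inf kappa_reg]
    by (intro conjI allI impI) (rule part1 part2; assumption)+
qed

end
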